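(* Let $q$ be a prime power and let $n$ be a positive integer with $4 \mid n$; put $\ell = n/4$. Then there exists a $q$-ary Singleton-optimal locally repairable code of length $n$, minimum distance $d=6$ and locality $r=3$ with disjoint repair groups if and only if there exist $\ell$ sets $B_1, B_2, \ldots, B_\ell$, each of which consists of $4$ lines in the projective plane $PG(2,q)$, such that for any $1 \le i \ne j \le \ell$: (i) $B_i \cap B_j = \emptyset$; (ii) there are no $3$ lines in $B_i \cup B_j$ through a common point.
   Context: Codes are linear: an $[n,k,d]_q$ code $C$ is a $k$-dimensional subspace of $\mathbb{F}_q^n$ with minimum Hamming distance $d$; $C^\perp$ is its dual code. $C$ is a locally repairable code (LRC) with locality $r$ if for every coordinate $i\in[n]=\{1,\dots,n\}$ there is a codeword $\bm h\in C^\perp$ with $i\in\mathrm{supp}(\bm h)$ and Hamming weight at most $r+1$. When $(r+1)\mid n$, $C$ has disjoint repair groups if there are $n/(r+1)$ codewords of $C^\perp$, each of Hamming weight exactly $r+1$, with pairwise disjoint supports (so the supports partition $[n]$). LRCs satisfy the Singleton-type bound $d\le n-k-\lceil k/r\rceil+2$; $C$ is called Singleton-optimal if equality holds. For $d=6$, $r=3$, $4\mid n$ this amounts to $n-k=n/4+3$. $PG(2,q)$ is the projective plane whose points and lines are the $1$- and $2$-dimensional subspaces of $\mathbb{F}_q^3$.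
   Formalization: For n = 4 the required code would have dimension 0, where minimum distance is undefined while the condition on lines always holds; the formal statement adopts the convention that the zero code has minimum distance d for every d. For n ≥ 8 nothing is changed. *)

theory Defs
  imports "HOL-Analysis.Cartesian_Space" "HOL-Library.Disjoint_Sets"
begin

text \<open>
  The field with \<open>q\<close> elements is a type \<open>'a :: {field, finite}\<close> with \<open>q = CARD('a)\<close> (necessarily a
  prime power), and the \<open>n\<close> coordinates are the elements of a finite type \<open>'n\<close> with
  \<open>n = CARD('n)\<close> (necessarily positive).
\<close>

definition supp :: "'a::zero ^ 'n \<Rightarrow> 'n set" where
  "supp x = {i. x $ i \<noteq> 0}"

definition hamming_weight :: "'a::zero ^ 'n::finite \<Rightarrow> nat" where
  "hamming_weight x = card (supp x)"

definition hamming_dist :: "'a ^ 'n::finite \<Rightarrow> 'a ^ 'n \<Rightarrow> nat" where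
  "hamming_dist x y = card {i. x $ i \<noteq> y $ i}"

definition dual_code :: "('a::field ^ 'n::finite) set \<Rightarrow> ('a ^ 'n) set" where
  "dual_code C = {h. \<forall>c\<in>C. (\<Sum>i\<in>UNIV. h $ i * c $ i) = 0}"

text \<open>
  For a code with at least two words, \<open>has_min_distance C d\<close> says that \<open>d\<close> is the least distance
  between distinct words. The zero code has no two distinct words; by convention it satisfies
  \<open>has_min_distance C d\<close> for every \<open>d\<close>.
  With \<open>d = 6\<close>, \<open>r = 3\<close> and \<open>4 dvd n\<close>, Singleton-optimality forces the dimension \<open>3 * n / 4 - 3\<close>, so
  the convention matters only for \<open>n = 4\<close>.
\<close>

definition has_min_distance :: "('a::field ^ 'n::finite) set \<Rightarrow> nat \<Rightarrow> bool" where
  "has_min_distance C d \<longleftrightarrow>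
     (\<forall>x\<in>C. \<forall>y\<in>C. x \<noteq> y \<longrightarrow> d \<le> hamming_dist x y) \<and>
     (C \<noteq> {0} \<longrightarrow> (\<exists>x\<in>C. \<exists>y\<in>C. x \<noteq> y \<and> hamming_dist x y = d))"

definition linear_code :: "('a::field ^ 'n::finite) set \<Rightarrow> nat \<Rightarrow> nat \<Rightarrow> bool" where
  "linear_code C k d \<longleftrightarrow> vec.subspace C \<and> vec.dim C = k \<and> has_min_distance C d"

definition has_locality :: "('a::field ^ 'n::finite) set \<Rightarrow> nat \<Rightarrow> bool" where
  "has_locality C r \<longleftrightarrow>
     (\<forall>i. \<exists>h\<in>dual_code C. i \<in> supp h \<and> hamming_weight h \<le> r + 1)"

definition has_disjoint_repair_groups :: "('a::field ^ 'n::finite) set \<Rightarrow> nat \<Rightarrow> bool" where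
  "has_disjoint_repair_groups C r \<longleftrightarrow>
     (r + 1) dvd CARD('n) \<and>
     (\<exists>H \<subseteq> dual_code C. card H = CARD('n) div (r + 1) \<and>
        (\<forall>h\<in>H. hamming_weight h = r + 1) \<and> disjoint_family_on supp H)"

definition singleton_optimal_lrc :: "('a::field ^ 'n::finite) set \<Rightarrow> nat \<Rightarrow> nat \<Rightarrow> bool" where
  "singleton_optimal_lrc C d r \<longleftrightarrow>
     (\<exists>k. linear_code C k d \<and> has_locality C r \<and>
        int d = int CARD('n) - int k - \<lceil>real k / real r\<rceil> + 2)"

definition pg2_points :: "('a::field ^ 3) set set" where
  "pg2_points = {P. vec.subspace P \<and> vec.dim P = 1}"

definition pg2_lines :: "('a::field ^ 3) set set" where
  "pg2_lines = {L. vec.subspace L \<and> vec.dim L = 2}"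

definition three_concurrent :: "('a::field ^ 3) set set \<Rightarrow> bool" where
  "three_concurrent S \<longleftrightarrow>
     (\<exists>T \<subseteq> S. card T = 3 \<and> (\<exists>P \<in> pg2_points. \<forall>L\<in>T. P \<subseteq> L))"

end

theory Submission
  imports Defs
begin

text \<open>
  Singleton-optimality means \<open>dim C + 3 = 3 * l\<close>. The \<open>l\<close> repair words cut out a space \<open>D\<close> of
  dimension \<open>3 * l\<close>, so \<open>C\<close> is the kernel in \<open>D\<close> of a linear map \<open>A\<close> to the 3-space. The words of \<open>D\<close>
  supported in one group of size 4 and vanishing at one of its coordinates form a plane, whose
  image under \<open>A\<close> is a line of \<open>PG(2,q)\<close>; each group yields four of them. A common point of three
  lines from two groups would yield a nonzero codeword of weight at most 5.

  Conversely, label the coordinates of group \<open>i\<close> by the lines of \<open>B i\<close>, with equations \<open>f a\<close>. The code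
  consists of the words \<open>a \<mapsto> f a \<bullet> p (g a)\<close>, where \<open>g a\<close> is the group of \<open>a\<close> and \<open>p\<close> assigns to each
  group a vector of the 3-space such that the sum of all \<open>p i\<close> is 0. If exactly two \<open>p i\<close> are nonzero,
  they span the same point, which lies on at most two of the eight lines, so the weight is at
  least 6; three nonzero \<open>p i\<close> contribute weight at least 2 each. The conditions on lines are empty
  for \<open>l = 1\<close>, and there the zero code is used instead.
\<close>

subsection \<open>Linear algebra over a field\<close>

definition dot :: "'a::field ^ 'n::finite \<Rightarrow> 'a ^ 'n \<Rightarrow> 'a" where
  "dot h x = (\<Sum>i\<in>UNIV. h $ i * x $ i)"

lemma dot_zero [simp]: "dot h 0 = 0" "dot 0 h = 0"
  by (simp_all add: dot_def)

lemma dot_add: "dot h (x + y) = dot h x + dot h y"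
  by (simp add: dot_def algebra_simps sum.distrib)

lemma dot_scale: "dot h (c *s x) = c * dot h x"
  by (simp add: dot_def sum_distrib_left algebra_simps)

lemma dot_minus: "dot h (- x) = - dot h x"
  by (simp add: dot_def sum_negf)

lemma dot_diff: "dot h (x - y) = dot h x - dot h y"
  by (simp add: dot_def algebra_simps sum_subtractf)

lemma dot_axis: "dot h (axis i c) = h $ i * c"
  by (simp add: dot_def axis_def if_distrib [of "\<lambda>x. _ * x"] cong: if_cong)

lemma axis_nth_if: "axis i c $ j = (if j = i then c else 0)"
  by (simp add: axis_def)

lemma axis_dot: "dot (axis i c) x = c * x $ i"
  by (simp add: dot_def axis_def if_distrib [of "\<lambda>x. x * _"] cong: if_cong)

lemma subspace_Int_dot:
  "vec.subspace V \<Longrightarrow> vec.subspace {x \<in> V. dot h x = 0}"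
  by (auto simp: vec.subspace_def dot_add dot_scale)

lemma subspace_supp: "vec.subspace {x :: 'a::field ^ 'n. supp x \<subseteq> S}"
  unfolding vec.subspace_def supp_def by (auto simp: subset_iff) (metis add.right_neutral)

lemma mult_vec_nth: "(A *v x) $ i = dot (A $ i) x"
  by (simp add: matrix_vector_mult_def dot_def)

text \<open>Subtracting \<open>(dot h x / dot h v) *s v\<close> moves any \<open>x\<close> of
  \<open>V\<close> into the kernel of \<open>h\<close>, so \<open>V\<close> is spanned by that
  kernel together with \<open>v\<close>, which lies outside it.\<close>

lemma dim_hyperplane:
  assumes V: "vec.subspace V" and v: "v \<in> V" "dot h v \<noteq> 0"
  shows "vec.dim V = Suc (vec.dim {x \<in> V. dot h x = 0})"
proof -
  let ?W = "{x \<in> V. dot h x = 0}"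
  have W: "vec.span ?W = ?W"
    using subspace_Int_dot [OF V] by (simp add: vec.span_eq_iff)
  have "V \<subseteq> vec.span (insert v ?W)"
  proof
    fix x assume x: "x \<in> V"
    have "x - (dot h x / dot h v) *s v \<in> vec.span ?W"
      unfolding W using V v x by (simp add: dot_diff dot_scale vec.subspace_diff vec.subspace_scale)
    then show "x \<in> vec.span (insert v ?W)"
      unfolding vec.span_insert by blast
  qed
  moreover have "vec.span (insert v ?W) \<subseteq> V"
    using V v by (intro vec.span_minimal) auto
  ultimately have "vec.dim V = vec.dim (insert v ?W)"
    by (metis subset_antisym vec.dim_span)
  also have "\<dots> = Suc (vec.dim ?W)"
    unfolding vec.dim_insert W using v by simp
  finally show ?thesis .
qed

text \<open>The vectors \<open>u h\<close> are dual to \<open>H\<close> up to scalars: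
  \<open>u h\<close> lies in the kernel of every other member of \<open>H\<close> but not in that of
  \<open>h\<close>. Imposing the equations one by one therefore lowers the dimension by exactly one
  each time.\<close>

lemma dim_annihilator:
  fixes H :: "('a::field ^ 'n::finite) set"
  assumes "finite H" and V: "vec.subspace V"
    and "\<And>h. h \<in> H \<Longrightarrow> u h \<in> V \<and> dot h (u h) \<noteq> 0"
    and "\<And>h h'. h \<in> H \<Longrightarrow> h' \<in> H \<Longrightarrow> h \<noteq> h' \<Longrightarrow> dot h' (u h) = 0"
  shows "vec.dim {x \<in> V. \<forall>h\<in>H. dot h x = 0} + card H = vec.dim V"
  using assms(1,3,4)
proof (induction H rule: finite_induct)
  case (insert h H)
  let ?W = "{x \<in> V. \<forall>h\<in>H. dot h x = 0}"
  have sub: "vec.subspace ?W"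
    using V by (auto simp: vec.subspace_def dot_add dot_scale)
  have "u h \<in> ?W" "dot h (u h) \<noteq> 0"
    using insert by auto
  from dim_hyperplane [OF sub this]
  have "vec.dim ?W = Suc (vec.dim {x \<in> ?W. dot h x = 0})" .
  moreover have "{x \<in> ?W. dot h x = 0} = {x \<in> V. \<forall>h\<in>insert h H. dot h x = 0}"
    by auto
  moreover have "vec.dim ?W + card H = vec.dim V"
    using insert by auto
  ultimately show ?case
    using insert by simp
qed simp

text \<open>Vanishing outside \<open>S\<close> is annihilation by the unit vectors at the
  coordinates in \<open>- S\<close>, which are their own dual system.\<close>

lemma dim_supp_subset:
  "vec.dim {x :: 'a::field ^ 'n::finite. supp x \<subseteq> S} = card S"
proof -
  let ?H = "(\<lambda>i. axis i (1::'a) :: 'a ^ 'n) ` (- S)"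
  have "vec.dim {x \<in> UNIV. \<forall>h\<in>?H. dot h x = 0} + card ?H = vec.dim (UNIV :: ('a ^ 'n) set)"
    by (rule dim_annihilator [where u = "\<lambda>h. h"]) (auto simp: axis_dot axis_nth_if axis_eq_axis)
  moreover have "{x \<in> UNIV. \<forall>h\<in>?H. dot h x = 0} = {x. supp x \<subseteq> S}"
    by (auto simp: axis_dot supp_def)
  moreover have "card ?H = card (- S)"
    by (intro card_image) (auto simp: inj_on_def axis_eq_axis)
  moreover have "card (- S) + card S = CARD('n)"
    using card_Un_disjoint [of "- S" S] by simp
  ultimately show ?thesis
    by (simp add: card_cart_basis)
qed

text \<open>A basis \<open>S\<close> of \<open>C\<close> is extended to a basis \<open>T\<close> of
  \<open>D\<close>. The dimension gap allows a map sending \<open>S\<close> to 0 and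
  \<open>T - S\<close> bijectively to the standard basis; it is injective on the span of
  \<open>T - S\<close>, so its kernel on \<open>D\<close> is \<open>C\<close>.\<close>

lemma exists_matrix_with_kernel:
  fixes C D :: "('a::field ^ 'n::finite) set"
  assumes C: "vec.subspace C" and D: "vec.subspace D" and "C \<subseteq> D"
    and dim: "vec.dim D = vec.dim C + CARD('m)"
  shows "\<exists>A :: 'a ^ 'n ^ 'm::finite. \<forall>x\<in>D. A *v x = 0 \<longleftrightarrow> x \<in> C"
proof -
  obtain S where S: "S \<subseteq> C" "vec.independent S" "C \<subseteq> vec.span S" "card S = vec.dim C"
    by (rule vec.basis_exists)
  have "S \<subseteq> D"
    using S(1) \<open>C \<subseteq> D\<close> by simp
  then obtain T where T: "S \<subseteq> T" "T \<subseteq> D" "vec.independent T" "D \<subseteq> vec.span T"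
    by (rule vec.maximal_independent_subset_extend [OF _ S(2)])
  have fin: "finite T"
    by (rule vec.finiteI_independent [OF T(3)])
  have cardT: "card T = vec.dim D"
    by (rule vec.basis_card_eq_dim [OF T(2,4,3)])
  have "card (T - S) = card (cart_basis :: ('a ^ 'm) set)"
    using dim S T fin cardT by (simp add: card_cart_basis card_Diff_subset finite_subset)
  then obtain b where b: "bij_betw b (T - S) (cart_basis :: ('a ^ 'm) set)"
    using fin finite_same_card_bij [of "T - S" "cart_basis :: ('a ^ 'm) set"] finite_cart_basis
    by auto
  obtain f where f: "Vector_Spaces.linear (*s) (*s) f" "\<forall>x\<in>T. f x = (if x \<in> S then 0 else b x)"
    using vec.linear_independent_extend [OF T(3), of "\<lambda>x. if x \<in> S then 0 else b x"] by auto
  interpret f: Vector_Spaces.linear "(*s)" "(*s)" f by fact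
  have "f ` (T - S) = b ` (T - S)"
    using f(2) by (intro image_cong) auto
  then have img: "f ` (T - S) = cart_basis"
    using b by (simp add: bij_betw_def)
  have f0: "f x = 0" if "x \<in> vec.span S" for x
    using f.eq_0_on_span [OF _ that] f(2) T(1) by (simp add: subset_iff)
  have "inj_on f (T - S)"
    using inj_on_cong [of "T - S" f b] f(2) b by (simp add: bij_betw_def)
  then have inj: "inj_on f (vec.span (T - S))"
    using f.inj_on_span_iff_independent_image [of "T - S"] by (simp add: img independent_cart_basis)
  have "f x = 0 \<longleftrightarrow> x \<in> C" if "x \<in> D" for x
  proof
    assume "f x = 0"
    have "S \<union> (T - S) = T"
      using T(1) by blast
    then have "x \<in> vec.span (S \<union> (T - S))"
      using that T(4) by (metis subsetD)
    then obtain y z where yz: "x = y + z" "y \<in> vec.span S" "z \<in> vec.span (T - S)"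
      unfolding vec.span_Un by auto
    then have "f z = f 0"
      using \<open>f x = 0\<close> f0 by (simp add: f.add f.zero)
    then have "z = 0"
      using inj yz(3) vec.span_zero by (metis inj_onD)
    then show "x \<in> C"
      using yz(1,2) vec.span_minimal [OF S(1) C] by auto
  next
    assume "x \<in> C"
    then show "f x = 0" using S(3) f0 by blast
  qed
  then have "\<forall>x\<in>D. matrix f *v x = 0 \<longleftrightarrow> x \<in> C"
    by (simp add: matrix_works [OF f(1)])
  then show ?thesis by blast
qed

lemma exists_functional_with_kernel:
  fixes C D :: "('a::field ^ 'n::finite) set"
  assumes "vec.subspace C" "vec.subspace D" "C \<subseteq> D" "vec.dim D = Suc (vec.dim C)"
  shows "\<exists>h. \<forall>x\<in>D. dot h x = 0 \<longleftrightarrow> x \<in> C"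
proof -
  have "\<exists>A :: 'a ^ 'n ^ 1. \<forall>x\<in>D. A *v x = 0 \<longleftrightarrow> x \<in> C"
    using assms by (intro exists_matrix_with_kernel) auto
  then obtain A :: "'a ^ 'n ^ 1" where A: "\<forall>x\<in>D. A *v x = 0 \<longleftrightarrow> x \<in> C" ..
  have "A *v x = 0 \<longleftrightarrow> dot (A $ 1) x = 0" for x
    by (simp add: vec_eq_iff mult_vec_nth)
  with A show ?thesis by auto
qed

text \<open>The sum of the two spaces fits into the whole space, so the dimension formula leaves a
  positive dimension for the intersection. In the plane this gives the common point of two
  lines.\<close>

lemma Int_nonzero:
  assumes "vec.subspace V" "vec.subspace W"
    and "CARD('n) < vec.dim V + vec.dim W"
  obtains x :: "'a::field ^ 'n::finite" where "x \<noteq> 0" "x \<in> V" "x \<in> W"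
proof -
  have "vec.dim {x + y | x y. x \<in> V \<and> y \<in> W} \<le> CARD('n)"
    using vec.dim_subset_UNIV by (simp add: card_cart_basis vec.dimension_def)
  then have "vec.dim (V \<inter> W) \<noteq> 0"
    using vec.dim_sums_Int [OF assms(1,2)] assms(3) by linarith
  then have "\<not> V \<inter> W \<subseteq> {0}"
    by (metis vec.dim_eq_0)
  then show thesis using that by blast
qed

text \<open>With \<open>c\<close> for the ceiling, the equation is
  \<open>k + c = 4 * (l - 1)\<close> over the integers. Since
  \<open>3 * c - 3 < k \<le> 3 * c\<close>, its only solution is \<open>c = l - 1\<close>,
  \<open>k = 3 * c\<close>.\<close>

lemma singleton_bound_iff:
  "(6::int) = int (4 * l) - int k - \<lceil>real k / real 3\<rceil> + 2 \<longleftrightarrow> k + 3 = 3 * l"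
proof -
  define c where "c = \<lceil>real k / real 3\<rceil>"
  have "real_of_int c - 1 < real k / 3" "real k / 3 \<le> real_of_int c"
    unfolding c_def by linarith+
  then have "3 * c - 3 < int k" "int k \<le> 3 * c" by linarith+
  then show ?thesis unfolding c_def [symmetric] by presburger
qed

section \<open>Weights, supports and orthogonality of words\<close>

lemma hamming_dist_eq_weight:
  "hamming_dist x y = hamming_weight (x - y :: 'a::field ^ 'n::finite)"
  by (simp add: hamming_dist_def hamming_weight_def supp_def)

lemma supp_zero [simp]: "supp (0 :: 'a::field ^ 'n) = {}"
  by (simp add: supp_def)

lemma supp_eq_empty [simp]: "supp x = {} \<longleftrightarrow> x = (0 :: 'a::field ^ 'n)"
  by (auto simp: supp_def vec_eq_iff)

lemma supp_diff_subset: "supp (x - y :: 'a::field ^ 'n) \<subseteq> supp x \<union> supp y"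
  by (auto simp: supp_def)

lemma dot_eq_0_disjoint: "supp h \<inter> supp x = {} \<Longrightarrow> dot h x = 0"
  by (auto simp: dot_def supp_def intro!: sum.neutral)

lemma dual_code_iff: "h \<in> dual_code C \<longleftrightarrow> (\<forall>c\<in>C. dot h c = 0)"
  by (simp add: dual_code_def dot_def)

subsection \<open>From codes to lines\<close>

text \<open>When repair words have disjoint supports, a word supported in the group of
  \<open>h\<close> is orthogonal to all the others, so the equation of \<open>h\<close> is the only
  one to impose.\<close>

definition repair_words :: "'a::field ^ 'n::finite \<Rightarrow> 'n \<Rightarrow> ('a ^ 'n) set" where
  "repair_words h a = {y. supp y \<subseteq> supp h - {a} \<and> dot h y = 0}"

lemma subspace_repair_words: "vec.subspace (repair_words h a)"
  unfolding repair_words_def using subspace_Int_dot [OF subspace_supp] by auto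

text \<open>Three free coordinates remain and \<open>h\<close> is nonzero at each of them, so its
  equation cuts the dimension from 3 to 2.\<close>

lemma dim_repair_words:
  fixes h :: "'a::field ^ 'n::finite"
  assumes "hamming_weight h = 4" "a \<in> supp h"
  shows "vec.dim (repair_words h a) = 2"
proof -
  have card: "card (supp h - {a}) = 3"
    using assms by (simp add: hamming_weight_def)
  then obtain b where b: "b \<in> supp h - {a}"
    by (metis card.empty ex_in_conv zero_neq_numeral)
  have "vec.dim {y :: 'a ^ 'n. supp y \<subseteq> supp h - {a}}
      = Suc (vec.dim {y \<in> {y. supp y \<subseteq> supp h - {a}}. dot h y = 0})"
  proof (rule dim_hyperplane [OF subspace_supp])
    show "axis b 1 \<in> {y :: 'a ^ 'n. supp y \<subseteq> supp h - {a}}" "dot h (axis b 1) \<noteq> 0"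
      using b by (auto simp: supp_def axis_nth_if dot_axis split: if_splits)
  qed
  then show ?thesis
    by (simp add: dim_supp_subset card repair_words_def)
qed

text \<open>Reciprocals of the entries of \<open>h\<close>, with opposite signs, cancel in the
  product. These words serve to tell the lines apart.\<close>

lemma exists_weight2_word:
  assumes "b \<in> supp h" "c \<in> supp h" "b \<noteq> c"
  obtains y :: "'a::field ^ 'n::finite" where "supp y = {b, c}" "dot h y = 0"
proof
  let ?y = "axis b (1 / h $ b) - axis c (1 / h $ c)"
  show "supp ?y = {b, c}"
    using assms by (auto simp: supp_def axis_nth_if)
  show "dot h ?y = 0"
    using assms by (simp add: dot_diff dot_axis supp_def)
qed

text \<open>The sets of lines are indexed by the repair words themselves. All three properties
  follow from the injectivity of \<open>A\<close> on words with small joint support.\<close>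

lemma pg2_lines_of_code:
  fixes C :: "('a::field ^ 'n::finite) set"
  assumes C: "vec.subspace C" and dim: "vec.dim C + 3 = 3 * l" and n: "CARD('n) = 4 * l"
    and dist: "\<And>x. x \<in> C \<Longrightarrow> x \<noteq> 0 \<Longrightarrow> 6 \<le> hamming_weight x"
    and H: "H \<subseteq> dual_code C" "card H = l" "\<And>h. h \<in> H \<Longrightarrow> hamming_weight h = 4"
    and disj: "disjoint_family_on supp H"
  shows "\<exists>B :: ('a ^ 'n) \<Rightarrow> ('a ^ 3) set set.
    (\<forall>h\<in>H. B h \<subseteq> pg2_lines \<and> card (B h) = 4) \<and>
    (\<forall>h\<in>H. \<forall>g\<in>H. h \<noteq> g \<longrightarrow> B h \<inter> B g = {} \<and> \<not> three_concurrent (B h \<union> B g))"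
proof -
  have disjD: "supp h \<inter> supp g = {}" if "h \<in> H" "g \<in> H" "h \<noteq> g" for h g
    using disj that by (auto simp: disjoint_family_on_def)
  \<comment> \<open>An infinite set has \<open>card\<close> 0 by convention, so
    \<open>card H = l\<close> with nonzero \<open>l\<close> gives finiteness.\<close>
  have "l \<noteq> 0"
    using n by (metis mult_0_right zero_less_card_finite less_irrefl)
  then have finH: "finite H"
    using H(2) card.infinite by fastforce
  have card4: "card (supp h) = 4" if "h \<in> H" for h
    using H(3) [OF that] by (simp add: hamming_weight_def)
  define D where "D = {x. \<forall>h\<in>H. dot h x = 0}"
  have "\<exists>i. i \<in> supp h" if "h \<in> H" for h
    using card4 [OF that] by (metis card.empty ex_in_conv zero_neq_numeral)
  then obtain r where r: "r h \<in> supp h" if "h \<in> H" for h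
    by metis
  \<comment> \<open>Because supports are disjoint, the unit vectors at the chosen coordinates
    \<open>r h\<close> form a dual system for \<open>H\<close>.\<close>
  have "vec.dim {x \<in> UNIV. \<forall>h\<in>H. dot h x = 0} + card H = vec.dim (UNIV :: ('a ^ 'n) set)"
  proof (rule dim_annihilator [where u = "\<lambda>h. axis (r h) 1"])
    show "dot h' (axis (r h) 1) = 0" if "h \<in> H" "h' \<in> H" "h \<noteq> h'" for h h'
      using disjD [OF that] r [OF that(1)] by (auto simp: dot_axis supp_def)
  qed (use finH r in \<open>auto simp: dot_axis supp_def\<close>)
  then have "vec.dim D + l = 4 * l"
    by (simp add: D_def H(2) n card_cart_basis)
  then have dimD: "vec.dim D = vec.dim C + CARD(3)"
    using dim by simp
  have subD: "vec.subspace D"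
    by (auto simp: D_def vec.subspace_def dot_add dot_scale)
  have "C \<subseteq> D"
    using H(1) by (auto simp: D_def dual_code_iff)
  from exists_matrix_with_kernel [OF C subD this dimD]
  obtain A :: "'a ^ 'n ^ 3" where A: "\<forall>x\<in>D. A *v x = 0 \<longleftrightarrow> x \<in> C" ..
  \<comment> \<open>The difference \<open>y - z\<close> is a codeword of weight at most 5, hence
    zero. This is where the minimum distance enters.\<close>
  have key: "y = z" if "y \<in> D" "z \<in> D" "A *v y = A *v z" "card (supp y \<union> supp z) \<le> 5" for y z
  proof -
    have "y - z \<in> D" "A *v (y - z) = 0"
      using that subD by (auto simp: vec.subspace_diff matrix_vector_mult_diff_distrib)
    then have "y - z \<in> C" using A by blast
    moreover have "hamming_weight (y - z) \<le> card (supp y \<union> supp z)"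
      unfolding hamming_weight_def by (intro card_mono supp_diff_subset) auto
    ultimately show ?thesis
      using dist [of "y - z"] that(4) by force
  qed
  have in_D: "y \<in> D" if "h \<in> H" "supp y \<subseteq> supp h" "dot h y = 0" for h y
    unfolding D_def
  proof clarify
    fix g assume "g \<in> H"
    then show "dot g y = 0"
      using that disjD [of g h] dot_eq_0_disjoint [of g y] by (cases "g = h") auto
  qed
  have words_D: "repair_words h a \<subseteq> D" if "h \<in> H" for h a
    using in_D [OF that] by (auto simp: repair_words_def)
  have card_words: "card (supp y) \<le> 3" if "h \<in> H" "a \<in> supp h" "y \<in> repair_words h a" for h a y
  proof -
    have "card (supp y) \<le> card (supp h - {a})"
      using that by (intro card_mono) (auto simp: repair_words_def)
    then show ?thesis using card4 that by simp
  qed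
  have inj_group: "y = z" if "h \<in> H" "y \<in> D" "z \<in> D" "supp y \<subseteq> supp h" "supp z \<subseteq> supp h"
    "A *v y = A *v z" for h y z
  proof -
    have "card (supp y \<union> supp z) \<le> card (supp h)"
      using that by (intro card_mono) auto
    then show ?thesis using key that card4 [of h] by simp
  qed
  have words_supp: "supp y \<subseteq> supp h" if "y \<in> repair_words h a" for y h a
    using that by (auto simp: repair_words_def)
  define L where "L h a = (*v) A ` repair_words h a" for h a
  define B where "B h = L h ` supp h" for h
  have lines: "L h a \<in> pg2_lines" if "h \<in> H" "a \<in> supp h" for h a
  proof -
    have "inj_on ((*v) A) (repair_words h a)"
      using inj_group [OF that(1)] words_D [OF that(1)] words_supp by (meson inj_onI subsetD)
    then have "vec.dim (L h a) = 2"
      unfolding L_def using dim_repair_words [OF H(3) that(2)] that(1) subspace_repair_words [of h a]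
      by (subst vec.dim_image_eq) (auto simp: vec.span_eq_iff [THEN iffD2])
    moreover have "vec.subspace (L h a)"
      unfolding L_def by (intro vec.subspace_image subspace_repair_words)
    ultimately show ?thesis by (simp add: pg2_lines_def)
  qed
  have third: "\<exists>c\<in>supp h. c \<noteq> a \<and> c \<noteq> b" if "h \<in> H" for h a b
  proof (rule ccontr)
    assume "\<not> ?thesis"
    then have "card (supp h) \<le> card {a, b}"
      by (intro card_mono) auto
    then show False using card4 [OF that] by (cases "a = b") auto
  qed
  \<comment> \<open>A word with support \<open>{b, c}\<close> lies in the plane of \<open>a\<close>.
    If the lines of \<open>a\<close> and \<open>b\<close> agreed, it would lie in the plane of
    \<open>b\<close> too, although it is nonzero at \<open>b\<close>.\<close>
  have inj_L: "inj_on (L h) (supp h)" if h: "h \<in> H" for h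
  proof (rule inj_onI, rule ccontr)
    fix a b assume ab: "a \<in> supp h" "b \<in> supp h" "L h a = L h b" "a \<noteq> b"
    obtain c where c: "c \<in> supp h" "c \<noteq> a" "c \<noteq> b"
      using third [OF h] by metis
    obtain y where y: "supp y = {b, c}" "dot h y = 0"
      using exists_weight2_word [OF ab(2) c(1)] c(3) by metis
    then have ya: "y \<in> repair_words h a"
      using ab c by (auto simp: repair_words_def)
    then obtain z where z: "z \<in> repair_words h b" "A *v y = A *v z"
      using ab(3) unfolding L_def by blast
    have "y = z"
      using inj_group [OF h _ _ _ _ z(2)] words_D [OF h] words_supp ya z(1) by blast
    then show False
      using z(1) y(1) by (auto simp: repair_words_def)
  qed
  \<comment> \<open>\<open>M\<close> and \<open>M'\<close> come from the same group, while
    \<open>g\<close> may equal \<open>h\<close>. The preimage of \<open>p\<close> in group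
    \<open>h\<close> vanishes at both \<open>a\<close> and \<open>b\<close>, so it has weight at
    most 2; with weight at most 3 for \<open>z\<close>, the bound 5 of \<open>key\<close> is
    met.\<close>
  have no_three: False
    if hg: "h \<in> H" "g \<in> H" and L: "M \<in> B h" "M' \<in> B h" "N \<in> B g" "M \<noteq> M'" "N \<noteq> M" "N \<noteq> M'"
      and p: "p \<noteq> 0" "p \<in> M" "p \<in> M'" "p \<in> N" for h g M M' N p
  proof -
    obtain a b c where abc: "a \<in> supp h" "b \<in> supp h" "c \<in> supp g"
      "M = L h a" "M' = L h b" "N = L g c"
      using L unfolding B_def by blast
    obtain x y z where xyz: "x \<in> repair_words h a" "y \<in> repair_words h b" "z \<in> repair_words g c"
      "p = A *v x" "p = A *v y" "p = A *v z"
      using p unfolding abc L_def by blast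
    have "x = y"
      using inj_group [OF hg(1)] words_D [OF hg(1)] words_supp xyz by (metis subsetD)
    then have supp_x: "supp x \<subseteq> supp h - {a, b}"
      using xyz by (auto simp: repair_words_def)
    have "a \<noteq> b" using abc L by auto
    have "card (supp x) \<le> card (supp h - {a, b})"
      using supp_x by (intro card_mono) auto
    also have "\<dots> = 2"
      using abc \<open>a \<noteq> b\<close> card4 [OF hg(1)] by (simp add: card_Diff_subset)
    finally have "card (supp x \<union> supp z) \<le> 5"
      using card_words [OF hg(2) abc(3) xyz(3)] card_Un_le [of "supp x" "supp z"] by linarith
    then have "x = z"
      using key xyz words_D hg by (metis subsetD)
    have "x \<noteq> 0" using p xyz by auto
    show False
    proof (cases "h = g")
      case True
      then have "c \<noteq> a" "c \<noteq> b" using abc L by auto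
      \<comment> \<open>At most one coordinate \<open>d\<close> of \<open>supp h\<close> is left,
        and a word with a single nonzero entry there cannot be orthogonal to
        \<open>h\<close>.\<close>
      have "supp x \<subseteq> supp h - {a, b, c}"
        using supp_x xyz(3) \<open>x = z\<close> by (auto simp: repair_words_def)
      moreover have "card (supp h - {a, b, c}) = 1"
        using abc \<open>a \<noteq> b\<close> \<open>c \<noteq> a\<close> \<open>c \<noteq> b\<close> card4 [OF hg(1)] True by (simp add: card_Diff_subset)
      then obtain d where "supp h - {a, b, c} = {d}"
        using card_1_singletonE by metis
      ultimately have "supp x = {d}" "h $ d \<noteq> 0"
        using \<open>x \<noteq> 0\<close> supp_eq_empty [of x] by (auto simp: supp_def simp del: supp_eq_empty)
      then have "x = axis d (x $ d)" "x $ d \<noteq> 0"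
        by (auto simp: supp_def vec_eq_iff axis_nth_if)
      moreover have "dot h x = 0"
        using xyz(1) by (simp add: repair_words_def)
      ultimately show False
        using \<open>h $ d \<noteq> 0\<close> dot_axis [of h d "x $ d"] by simp
    next
      case False
      then have "supp x = {}"
        using disjD [OF hg False] words_supp xyz(1,3) \<open>x = z\<close> by fastforce
      then show False using \<open>x \<noteq> 0\<close> by simp
    qed
  qed
  have "B h \<subseteq> pg2_lines \<and> card (B h) = 4" if "h \<in> H" for h
    unfolding B_def using that lines card_image [OF inj_L] card4 by auto
  moreover have "B h \<inter> B g = {}" if hg: "h \<in> H" "g \<in> H" "h \<noteq> g" for h g
  proof (rule ccontr)
    assume "B h \<inter> B g \<noteq> {}"
    then obtain a b where ab: "a \<in> supp h" "b \<in> supp g" "L h a = L g b"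
      unfolding B_def by auto
    obtain c where c: "c \<in> supp h" "c \<noteq> a"
      using third [OF hg(1)] by metis
    obtain d where d: "d \<in> supp h" "d \<noteq> a" "c \<noteq> d"
      using third [OF hg(1)] by metis
    \<comment> \<open>A word of weight 2 in the plane of \<open>a\<close> is chosen because, with
      weight up to 3 for \<open>z\<close>, the total must not exceed 5.\<close>
    obtain y where y: "supp y = {c, d}" "dot h y = 0"
      using exists_weight2_word [OF c(1) d(1) d(3)] by metis
    then have ya: "y \<in> repair_words h a"
      using c d by (auto simp: repair_words_def)
    then obtain z where z: "z \<in> repair_words g b" "A *v y = A *v z"
      using ab(3) unfolding L_def by blast
    have "card (supp y \<union> supp z) \<le> 5"
      using card_words [OF hg(2) ab(2) z(1)] card_Un_le [of "supp y" "supp z"] y(1) d(3) by simp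
    then have "y = z"
      using key z ya words_D hg by (metis subsetD)
    then have "c \<in> supp g"
      using y(1) words_supp [OF z(1)] by auto
    then show False using disjD [OF hg] c(1) by auto
  qed
  moreover have "\<not> three_concurrent (B h \<union> B g)" if hg: "h \<in> H" "g \<in> H" "h \<noteq> g" for h g
  proof
    assume "three_concurrent (B h \<union> B g)"
    then obtain T P where T: "T \<subseteq> B h \<union> B g" "card T = 3" and P: "P \<in> pg2_points" "\<forall>L\<in>T. P \<subseteq> L"
      unfolding three_concurrent_def by auto
    obtain M1 M2 M3 where M: "T = {M1, M2, M3}" "M1 \<noteq> M2" "M1 \<noteq> M3" "M2 \<noteq> M3"
      using T(2) by (auto simp: card_3_iff)
    have "\<not> P \<subseteq> {0}"
      using P(1) vec.dim_eq_0 [of P] by (auto simp: pg2_points_def)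
    then obtain p where p: "p \<noteq> 0" "p \<in> M1" "p \<in> M2" "p \<in> M3"
      using P(2) M(1) by auto
    \<comment> \<open>By the pigeonhole principle two of the three lines lie in the same set, as
      \<open>no_three\<close> demands.\<close>
    have "M1 \<in> B h \<or> M1 \<in> B g" "M2 \<in> B h \<or> M2 \<in> B g" "M3 \<in> B h \<or> M3 \<in> B g"
      using T(1) M(1) by auto
    then show False
      using no_three hg(1,2) p M(2-4) by metis
  qed
  ultimately show ?thesis by blast
qed

subsection \<open>From lines to codes\<close>

lemma exists_line_equation:
  assumes "L \<in> pg2_lines"
  shows "\<exists>f. \<forall>x. dot f x = 0 \<longleftrightarrow> x \<in> (L :: ('a::field ^ 3) set)"
  using exists_functional_with_kernel [of L UNIV] assms
  by (auto simp: pg2_lines_def card_cart_basis)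

lemma dim_range_matrix:
  fixes A :: "'a::field ^ 'm::finite ^ 'n::finite"
  assumes "\<And>q. A *v q = 0 \<Longrightarrow> q = 0"
  shows "vec.dim (range ((*v) A)) = CARD('m)"
proof -
  have "inj ((*v) A)"
    using assms by (simp add: vec.inj_iff_eq_0)
  then show ?thesis
    using vec.dim_image_eq [of "(*v) A" UNIV] by (simp add: card_cart_basis)
qed

text \<open>For \<open>n = 4\<close> the optimal dimension is 0, and distance 6 holds by the
  convention for the zero code. The all-one word is the single repair word.\<close>

lemma zero_code_singleton_optimal:
  assumes "CARD('n::finite) = 4"
  shows "singleton_optimal_lrc ({0} :: ('a::field ^ 'n) set) 6 3"
    and "has_disjoint_repair_groups ({0} :: ('a::field ^ 'n) set) 3"
proof -
  define h :: "'a ^ 'n" where "h = (\<chi> i. 1)"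
  have h: "h \<in> dual_code {0}" "supp h = UNIV" "hamming_weight h = 4"
    using assms by (auto simp: h_def dual_code_def supp_def hamming_weight_def)
  have "has_locality ({0} :: ('a ^ 'n) set) 3"
    unfolding has_locality_def
  proof
    show "\<exists>h\<in>dual_code {0 :: 'a ^ 'n}. i \<in> supp h \<and> hamming_weight h \<le> 3 + 1" for i
      using h by (intro bexI [of _ h]) auto
  qed
  then show "singleton_optimal_lrc ({0} :: ('a ^ 'n) set) 6 3"
    using assms by (auto simp: singleton_optimal_lrc_def linear_code_def has_min_distance_def)
  show "has_disjoint_repair_groups ({0} :: ('a ^ 'n) set) 3"
    unfolding has_disjoint_repair_groups_def using h assms
    by (auto intro!: exI [of _ "{h}"] simp: disjoint_family_on_def)
qed

text \<open>A nonzero vector lies on at most two of the eight lines of two groups. This count yields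
  the dimension, the distance and the repair words; \<open>2 \<le> l\<close> extends it to the lines
  of a single group.\<close>

lemma code_of_pg2_lines:
  fixes B :: "nat \<Rightarrow> ('a::field ^ 3) set set"
  assumes n: "CARD('n::finite) = 4 * l" and l: "2 \<le> l"
    and lines: "\<And>i. i \<in> {1..l} \<Longrightarrow> B i \<subseteq> pg2_lines \<and> card (B i) = 4"
    and general: "\<And>i j. i \<in> {1..l} \<Longrightarrow> j \<in> {1..l} \<Longrightarrow> i \<noteq> j \<Longrightarrow>
      B i \<inter> B j = {} \<and> \<not> three_concurrent (B i \<union> B j)"
  shows "\<exists>C :: ('a ^ 'n) set. singleton_optimal_lrc C 6 3 \<and> has_disjoint_repair_groups C 3"
proof -

  \<comment> \<open>Labelling coordinates by lines and counting zeros\<close>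
  define I where "I = {1..l}"
  note lines = lines [folded I_def] and general = general [folded I_def]
  have finI: "finite I" and cardI: "card I = l" and I12: "1 \<in> I" "2 \<in> I"
    using l by (auto simp: I_def)
  have finB: "finite (B i)" if "i \<in> I" for i
    using lines [OF that] card.infinite by fastforce
  \<comment> \<open>There are as many pairs of a group index and a line of that group as
    coordinates; \<open>\<beta>\<close> identifies them, with components \<open>g\<close> and
    \<open>L\<close>.\<close>
  have "card (Sigma I B) = CARD('n)"
    using lines finB finI by (subst card_SigmaI) (auto simp: n cardI)
  then obtain \<beta> :: "'n \<Rightarrow> nat \<times> ('a ^ 3) set" where \<beta>: "bij_betw \<beta> UNIV (Sigma I B)"
    using finite_same_card_bij [of "UNIV :: 'n set" "Sigma I B"] finB finI by auto
  define g L where "g a = fst (\<beta> a)" and "L a = snd (\<beta> a)" for a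
  have gI: "g a \<in> I" and LB: "L a \<in> B (g a)" for a
    using bij_betw_apply [OF \<beta>, of a] by (auto simp: g_def L_def)
  have inj: "a = b" if "g a = g b" "L a = L b" for a b
    using that bij_betw_imp_inj_on [OF \<beta>] by (auto simp: g_def L_def inj_on_def prod_eq_iff)
  have surj: "\<exists>a. g a = i \<and> L a = M" if "i \<in> I" "M \<in> B i" for i M
  proof -
    have "(i, M) \<in> range \<beta>"
      using that bij_betw_imp_surj_on [OF \<beta>] by simp
    then obtain a where "\<beta> a = (i, M)" by (metis imageE)
    then have "g a = i \<and> L a = M" by (simp add: g_def L_def)
    then show ?thesis by blast
  qed
  define G where "G i = {a. g a = i}" for i
  have "bij_betw L (G i) (B i)" if "i \<in> I" for i
  proof -
    have "B i \<subseteq> L ` G i"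
      using surj [OF that] by (fastforce simp: G_def)
    then show ?thesis
      using inj LB by (auto simp: bij_betw_def inj_on_def G_def)
  qed
  then have card_G: "card (G i) = 4" if "i \<in> I" for i
    using lines that bij_betw_same_card by metis
  have "\<exists>f. \<forall>x. dot f x = 0 \<longleftrightarrow> x \<in> L a" for a
    using lines [OF gI] LB by (intro exists_line_equation) auto
  then obtain f where f: "dot (f a) x = 0 \<longleftrightarrow> x \<in> L a" for a x
    by metis
  have inj_L: "inj_on L (G i \<union> G j)" if "i \<in> I" "j \<in> I" "i \<noteq> j" for i j
  proof (rule inj_onI)
    fix a b assume "a \<in> G i \<union> G j" "b \<in> G i \<union> G j" "L a = L b"
    then have "g a = g b"
      using general [OF that] LB [of a] LB [of b] by (auto simp: G_def)
    then show "a = b" using inj \<open>L a = L b\<close> by blast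
  qed
  \<comment> \<open>The zeros correspond to lines through the point spanned by \<open>p\<close>.
    Since \<open>L\<close> is injective on the two groups, three zeros would give three distinct
    concurrent lines.\<close>
  have few_zeros: "card {a \<in> G i \<union> G j. dot (f a) p = 0} \<le> 2"
    if ij: "i \<in> I" "j \<in> I" "i \<noteq> j" and p: "p \<noteq> 0" for i j p
  proof (rule ccontr)
    let ?Z = "{a \<in> G i \<union> G j. dot (f a) p = 0}"
    assume "\<not> card ?Z \<le> 2"
    then have "3 \<le> card ?Z" by simp
    then obtain T where T: "T \<subseteq> ?Z" "card T = 3"
      by (rule obtain_subset_with_card_n)
    have "inj_on L T"
      using inj_on_subset [OF inj_L [OF ij]] T(1) by blast
    then have "card (L ` T) = 3"
      using T(2) by (simp add: card_image)
    moreover have "L ` T \<subseteq> B i \<union> B j"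
      using T(1) LB by (auto simp: G_def)
    moreover have "vec.span {p} \<in> pg2_points"
      using p by (simp add: pg2_points_def)
    moreover have "vec.span {p} \<subseteq> L a" if "a \<in> T" for a
    proof (rule vec.span_minimal)
      show "{p} \<subseteq> L a" using that T(1) f by auto
      show "vec.subspace (L a)"
        using lines [OF gI] LB by (auto simp: pg2_lines_def)
    qed
    ultimately have "three_concurrent (B i \<union> B j)"
      unfolding three_concurrent_def by blast
    then show False using general [OF ij] by simp
  qed
  \<comment> \<open>A second group always exists, so the bound for two groups can be applied to
    one.\<close>
  have other: "\<exists>j\<in>I. j \<noteq> i" for i
    using I12 by (intro bexI [of _ "if i = 1 then 2 else 1"]) auto
  have few_zeros_group: "card {a \<in> G i. dot (f a) p = 0} \<le> 2" if "i \<in> I" "p \<noteq> 0" for i p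
  proof -
    obtain j where j: "j \<in> I" "j \<noteq> i" using other by blast
    have "card {a \<in> G i. dot (f a) p = 0} \<le> card {a \<in> G i \<union> G j. dot (f a) p = 0}"
      by (intro card_mono) auto
    then show ?thesis using few_zeros [of i j p] that j by simp
  qed

  \<comment> \<open>The code and its dimension\<close>
  define word where "word p = (\<chi> a. dot (f a) (p (g a)))" for p :: "nat \<Rightarrow> 'a ^ 3"
  have word_cong: "word p = word q" if "\<And>i. i \<in> I \<Longrightarrow> p i = q i" for p q
    using that gI by (simp add: word_def)
  have word_add: "word p + word q = word (\<lambda>i. p i + q i)" for p q
    by (simp add: word_def vec_eq_iff dot_add)
  have word_diff: "word p - word q = word (\<lambda>i. p i - q i)" for p q
    by (simp add: word_def vec_eq_iff dot_diff)
  have word_scale: "c *s word p = word (\<lambda>i. c *s p i)" for c p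
    by (simp add: word_def vec_eq_iff dot_scale)
  have word_zero: "word (\<lambda>i. 0) = 0"
    by (simp add: word_def vec_eq_iff)
  \<comment> \<open>\<open>C\<close> is filtered by the subspaces \<open>S m\<close> where \<open>p\<close> is supported in \<open>{1..m}\<close>; each step adds 3 dimensions.\<close>
  define S where "S m = {word p | p. (\<forall>i. p i \<noteq> 0 \<longrightarrow> i \<in> {1..m}) \<and> sum p I = 0}" for m
  define C where "C = S l"
  \<comment> \<open>\<open>word p\<close> and the sum only see the values of \<open>p\<close> on
    \<open>I\<close>, so \<open>p\<close> may be cut off outside \<open>I\<close>.\<close>
  have C_iff: "x \<in> C \<longleftrightarrow> (\<exists>p. x = word p \<and> sum p I = 0)" for x
  proof
    assume "\<exists>p. x = word p \<and> sum p I = 0"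
    then obtain p where p: "x = word p" "sum p I = 0" by blast
    let ?q = "\<lambda>i. if i \<in> I then p i else 0"
    have "x = word ?q" "sum ?q I = 0"
      using p word_cong [of p ?q] by auto
    moreover have "\<forall>i. ?q i \<noteq> 0 \<longrightarrow> i \<in> {1..l}"
      by (simp add: I_def)
    ultimately show "x \<in> C"
      unfolding C_def S_def by blast
  qed (auto simp: C_def S_def)
  have sub_S: "vec.subspace (S m)" for m
    unfolding vec.subspace_def
  proof (intro conjI ballI allI)
    show "0 \<in> S m"
      unfolding S_def using word_zero by force
  next
    fix x y assume "x \<in> S m" "y \<in> S m"
    then obtain p q where pq: "x = word p" "y = word q" "\<forall>i. p i \<noteq> 0 \<longrightarrow> i \<in> {1..m}" "sum p I = 0"
       "\<forall>i. q i \<noteq> 0 \<longrightarrow> i \<in> {1..m}" "sum q I = 0"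
      unfolding S_def by blast
    have "\<forall>i. p i + q i \<noteq> 0 \<longrightarrow> i \<in> {1..m}"
      using pq(3,5) by (metis add.right_neutral)
    moreover have "(\<Sum>i\<in>I. p i + q i) = 0"
      by (simp add: sum.distrib pq(4,6))
    ultimately show "x + y \<in> S m"
      unfolding S_def pq(1,2) word_add by blast
  next
    fix c x assume "x \<in> S m"
    then obtain p where p: "x = word p" "\<forall>i. p i \<noteq> 0 \<longrightarrow> i \<in> {1..m}" "sum p I = 0"
      unfolding S_def by blast
    have "\<forall>i. c *s p i \<noteq> 0 \<longrightarrow> i \<in> {1..m}"
      using p(2) by (metis vec.scale_zero_right)
    moreover have "(\<Sum>i\<in>I. c *s p i) = 0"
      by (simp add: vec.scale_sum_right [symmetric] p(3))
    ultimately show "c *s x \<in> S m"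
      unfolding S_def p(1) word_scale by blast
  qed
  have sub_C: "vec.subspace C"
    unfolding C_def by (rule sub_S)

  \<comment> \<open>The sum condition costs three dimensions: in \<open>S 1\<close> it forces the
    only entry to vanish, so the filtration starts with the zero space.\<close>
  have "vec.dim (S m) + 3 = 3 * m" if "1 \<le> m" "m \<le> l" for m
    using that
  proof (induction m rule: nat_induct_at_least)
    case base
    have "p = (\<lambda>i. 0)" if "\<forall>i. p i \<noteq> 0 \<longrightarrow> i \<in> {1..1::nat}" "sum p I = 0" for p :: "nat \<Rightarrow> 'a ^ 3"
    proof -
      have "sum p I = sum p {1}"
        using that(1) I12 finI by (intro sum.mono_neutral_right) auto
      then have "p 1 = 0" using that(2) by simp
      then show ?thesis using that(1) by fastforce
    qed
    then have "S 1 \<subseteq> {0}"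
      unfolding S_def using word_zero by auto
    then show ?case by simp
  next
    case (Suc m)
    \<comment> \<open>\<open>A\<close> is the matrix of the map from \<open>q\<close> to the word
      with \<open>q\<close> in group \<open>Suc m\<close> and \<open>- q\<close> in group 1, which
      keeps the sum zero. Its range is to be a 3-dimensional complement of \<open>S m\<close> in
      \<open>S (Suc m)\<close>.\<close>
    define A where "A = (\<chi> a. if g a = Suc m then f a else if g a = 1 then - f a else 0)"
    define e where "e q = (\<lambda>i. if i = Suc m then q else if i = 1 then - q else 0)" for q :: "'a ^ 3"
    have A_word: "A *v q = word (e q)" for q
      by (auto simp: vec_eq_iff mult_vec_nth A_def word_def e_def dot_minus)
        (simp add: dot_def sum_negf)
    have SucI: "Suc m \<in> I" using Suc by (simp add: I_def)
    have sum_e: "sum (e q) I = 0" for q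
    proof -
      have "sum (e q) I = sum (e q) {Suc m, 1}"
        using SucI I12 finI by (intro sum.mono_neutral_right) (auto simp: e_def)
      then show ?thesis using Suc by (simp add: e_def)
    qed
    \<comment> \<open>Four zeros in one group exceed the bound 2. This gives both the injectivity of
      \<open>A\<close> and the trivial intersection of its range with \<open>S m\<close>.\<close>
    have zero_if: "q = 0" if "\<forall>a\<in>G (Suc m). word (e q) $ a = 0" for q
    proof (rule ccontr)
      assume "q \<noteq> 0"
      have "{a \<in> G (Suc m). dot (f a) q = 0} = G (Suc m)"
        using that by (auto simp: word_def e_def G_def)
      then show False
        using few_zeros_group [OF SucI \<open>q \<noteq> 0\<close>] card_G [OF SucI] by simp
    qed
    have sub_R: "vec.subspace (range ((*v) A))"
      by (intro vec.subspace_image vec.subspace_UNIV)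
    have "vec.dim (range ((*v) A)) = 3"
      using dim_range_matrix [of A] zero_if by (simp add: A_word)
    moreover have "S m \<inter> range ((*v) A) \<subseteq> {0}"
    proof clarify
      fix q assume "A *v q \<in> S m"
      then obtain p where p: "word (e q) = word p" "\<forall>i. p i \<noteq> 0 \<longrightarrow> i \<in> {1..m}"
        unfolding S_def A_word by blast
      then have "p (Suc m) = 0" by fastforce
      then have "q = 0"
        using p(1) by (intro zero_if) (simp add: word_def G_def)
      then show "A *v q = 0" by simp
    qed
    moreover have "{x + y | x y. x \<in> S m \<and> y \<in> range ((*v) A)} = S (Suc m)"
    proof (intro equalityI subsetI)
      fix z assume "z \<in> {x + y | x y. x \<in> S m \<and> y \<in> range ((*v) A)}"
      then obtain p q where z: "z = word (\<lambda>i. p i + e q i)" "\<forall>i. p i \<noteq> 0 \<longrightarrow> i \<in> {1..m}" "sum p I = 0"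
        unfolding S_def A_word by (auto simp: word_add)
      have "p i + e q i \<noteq> 0 \<longrightarrow> i \<in> {1..Suc m}" for i
        using z(2) by (cases "p i = 0") (auto simp: e_def)
      moreover have "(\<Sum>i\<in>I. p i + e q i) = 0"
        using z(3) sum_e by (simp add: sum.distrib)
      ultimately show "z \<in> S (Suc m)"
        unfolding S_def using z(1) by blast
    next
      fix z assume "z \<in> S (Suc m)"
      then obtain p where p: "z = word p" "\<forall>i. p i \<noteq> 0 \<longrightarrow> i \<in> {1..Suc m}" "sum p I = 0"
        unfolding S_def by blast
      \<comment> \<open>Subtracting \<open>e q\<close> clears entry \<open>Suc m\<close> and moves
        \<open>q\<close> into entry 1, which is allowed since \<open>1 \<le> m\<close>.\<close>
      define q where "q = p (Suc m)"
      have "p i - e q i \<noteq> 0 \<longrightarrow> i \<in> {1..m}" for i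
        using p(2) Suc.hyps by (cases "i = Suc m \<or> i = 1") (auto simp: e_def q_def le_Suc_eq)
      moreover have "(\<Sum>i\<in>I. p i - e q i) = 0"
        using p(3) sum_e by (simp add: sum_subtractf)
      ultimately have "word (\<lambda>i. p i - e q i) \<in> S m"
        unfolding S_def by blast
      moreover have "z = word (\<lambda>i. p i - e q i) + A *v q"
        by (simp add: A_word word_add p(1))
      ultimately show "z \<in> {x + y | x y. x \<in> S m \<and> y \<in> range ((*v) A)}" by blast
    qed
    ultimately have "vec.dim (S (Suc m)) = vec.dim (S m) + 3"
      using vec.dim_sums_Int [OF sub_S [of m] sub_R] vec.dim_eq_0 by (metis add.right_neutral)
    then show ?case using Suc by simp
  qed
  then have dim_C: "vec.dim C + 3 = 3 * l"
    using l by (simp add: C_def)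

  \<comment> \<open>Minimum distance of the code\<close>
  have weight_two_groups: "hamming_weight (word p) + card {a \<in> G i \<union> G j. dot (f a) q = 0} = 8"
    if ij: "i \<in> I" "j \<in> I" "i \<noteq> j" and p: "p i = q" "p j = - q" "\<forall>k\<in>I - {i, j}. p k = 0"
    for p q i j
  proof -
    let ?Z = "{a \<in> G i \<union> G j. dot (f a) q = 0}"
    have "p (g a) = (if g a = i then q else if g a = j then - q else 0)" for a
      using p gI [of a] by auto
    then have "supp (word p) = (G i \<union> G j) - ?Z"
      by (auto simp: supp_def word_def G_def dot_minus split: if_splits)
    moreover have "card (G i \<union> G j) = 8"
      using ij card_G by (subst card_Un_disjoint) (auto simp: G_def)
    moreover have "card ?Z \<le> card (G i \<union> G j)"
      by (intro card_mono) auto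
    moreover have "card ((G i \<union> G j) - ?Z) = card (G i \<union> G j) - card ?Z"
      by (rule card_Diff_subset) auto
    ultimately show ?thesis
      unfolding hamming_weight_def by simp
  qed
  have weight_ge: "6 \<le> hamming_weight x" if "x \<in> C" "x \<noteq> 0" for x
  proof -
    obtain p where p: "x = word p" "sum p I = 0"
      using \<open>x \<in> C\<close> C_iff by blast
    define J where "J = {i \<in> I. p i \<noteq> 0}"
    have finJ: "finite J" and JI: "J \<subseteq> I" using finI by (auto simp: J_def)
    have sumJ: "sum p J = 0"
      using p(2) finI by (subst sum.mono_neutral_left [of I]) (auto simp: J_def)
    have "J \<noteq> {}"
      using p(1) \<open>x \<noteq> 0\<close> word_cong [of p "\<lambda>i. 0"] word_zero by (auto simp: J_def)
    \<comment> \<open>A single nonzero vector cannot have sum zero.\<close>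
    moreover have "card J \<noteq> 1"
      using sumJ by (auto simp: card_1_singleton_iff J_def)
    moreover have "card J \<noteq> 0"
      using finJ \<open>J \<noteq> {}\<close> by simp
    ultimately consider "card J = 2" | "3 \<le> card J"
      by linarith
    then show ?thesis
    proof cases
      case 1
      then obtain i j where ij: "J = {i, j}" "i \<noteq> j"
        by (auto simp: card_2_iff)
      then have "p j = - p i"
        using sumJ by (simp add: eq_neg_iff_add_eq_0 add.commute)
      moreover have "i \<in> I" "j \<in> I" "p i \<noteq> 0" "\<forall>k\<in>I - {i, j}. p k = 0"
        using ij by (auto simp: J_def)
      ultimately show ?thesis
        using weight_two_groups [of i j p "p i"] few_zeros [of i j "p i"] ij p(1) by simp
    next
      case 2
      \<comment> \<open>Each group in \<open>J\<close> has four coordinates and at most two zeros,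
        so three groups already give weight 6.\<close>
      define N where "N i = {a \<in> G i. dot (f a) (p i) \<noteq> 0}" for i
      have "2 \<le> card (N i)" if "i \<in> J" for i
      proof -
        have "N i = G i - {a \<in> G i. dot (f a) (p i) = 0}"
          by (auto simp: N_def)
        moreover have "card (G i - {a \<in> G i. dot (f a) (p i) = 0})
            = card (G i) - card {a \<in> G i. dot (f a) (p i) = 0}"
          by (rule card_Diff_subset) auto
        ultimately show ?thesis
          using few_zeros_group [of i "p i"] card_G [of i] that by (auto simp: J_def)
      qed
      then have "2 * card J \<le> (\<Sum>i\<in>J. card (N i))"
        using sum_bounded_below [of J 2 "\<lambda>i. card (N i)"] by (simp add: mult.commute)
      also have "\<dots> = card (\<Union>i\<in>J. N i)"
        using finJ by (subst card_UN_disjoint) (auto simp: N_def G_def)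
      also have "\<dots> \<le> hamming_weight x"
        unfolding hamming_weight_def
        by (intro card_mono) (auto simp: N_def G_def p(1) supp_def word_def)
      finally show ?thesis using 2 by simp
    qed
  qed
  have "\<exists>x\<in>C. hamming_weight x = 6"
  proof -
    \<comment> \<open>Two lines of group 1 meet in a nonzero \<open>q\<close>, so \<open>q\<close>
      has exactly two zeros among the eight coordinates and the weight is 8 - 2.\<close>
    obtain a b where ab: "a \<in> G 1" "b \<in> G 1" "a \<noteq> b"
      using card_G [OF I12(1)] card_le_Suc0_iff_eq [of "G 1"] by force
    have La: "vec.subspace (L a)" "vec.dim (L a) = 2" for a
      using lines [OF gI] LB by (auto simp: pg2_lines_def)
    obtain q where q: "q \<noteq> 0" "q \<in> L a" "q \<in> L b"
      by (rule Int_nonzero [OF La(1) La(1), of a b]) (auto simp: La(2))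
    define p where "p i = (if i = 1 then q else if i = 2 then - q else 0)" for i :: nat
    have "sum p I = sum p {1, 2}"
      using I12 finI by (intro sum.mono_neutral_right) (auto simp: p_def)
    then have "word p \<in> C"
      unfolding C_iff by (auto simp: p_def)
    moreover have "{a, b} \<subseteq> {a \<in> G 1 \<union> G 2. dot (f a) q = 0}"
      using ab q f by auto
    then have "card {a, b} \<le> card {a \<in> G 1 \<union> G 2. dot (f a) q = 0}"
      by (intro card_mono) auto
    then have "card {a \<in> G 1 \<union> G 2. dot (f a) q = 0} = 2"
      using few_zeros [OF I12 _ q(1)] ab(3) by simp
    then have "hamming_weight (word p) = 6"
      using weight_two_groups [OF I12, of p q] by (simp add: p_def)
    ultimately show ?thesis by blast
  qed
  then obtain w where w: "w \<in> C" "hamming_weight w = 6" by blast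
  have "has_min_distance C 6"
    unfolding has_min_distance_def
  proof (intro conjI impI ballI)
    fix x y assume "x \<in> C" "y \<in> C" "x \<noteq> y"
    then show "6 \<le> hamming_dist x y"
      using weight_ge [of "x - y"] sub_C by (simp add: hamming_dist_eq_weight vec.subspace_diff)
  next
    show "\<exists>x\<in>C. \<exists>y\<in>C. x \<noteq> y \<and> hamming_dist x y = 6"
      using w vec.subspace_0 [OF sub_C]
      by (intro bexI [of _ w] bexI [of _ 0]) (auto simp: hamming_dist_eq_weight hamming_weight_def)
  qed
  then have code: "linear_code C (vec.dim C) 6"
    by (simp add: linear_code_def sub_C)

  \<comment> \<open>Restricted to group \<open>i\<close>, codewords fill only a 3-dimensional subspace of the 4-space; its equation
    is the repair word.\<close>
  have "\<exists>h\<in>dual_code C. supp h = G i" if i: "i \<in> I" for i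
  proof -
    define A where "A = (\<chi> a. if g a = i then f a else 0)"
    have A_nth: "(A *v q) $ a = (if g a = i then dot (f a) q else 0)" for q a
      by (simp add: mult_vec_nth A_def)
    have "q = 0" if "A *v q = 0" for q
    proof (rule ccontr)
      assume "q \<noteq> 0"
      have "dot (f a) q = 0" if "a \<in> G i" for a
        using A_nth [of q a] \<open>A *v q = 0\<close> that by (simp add: G_def)
      then have "{a \<in> G i. dot (f a) q = 0} = G i"
        by blast
      then show False
        using few_zeros_group [OF i \<open>q \<noteq> 0\<close>] card_G [OF i] by simp
    qed
    then have "vec.dim (range ((*v) A)) = 3"
      by (subst dim_range_matrix) auto
    then have "vec.dim {x :: 'a ^ 'n. supp x \<subseteq> G i} = Suc (vec.dim (range ((*v) A)))"
      by (simp add: dim_supp_subset card_G i)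
    moreover have "vec.subspace (range ((*v) A))"
      by (intro vec.subspace_image vec.subspace_UNIV)
    moreover have range_A: "range ((*v) A) \<subseteq> {x. supp x \<subseteq> G i}"
      by (auto simp: supp_def A_nth G_def split: if_splits)
    ultimately obtain k where k: "\<forall>x\<in>{x. supp x \<subseteq> G i}. dot k x = 0 \<longleftrightarrow> x \<in> range ((*v) A)"
      using exists_functional_with_kernel [OF _ subspace_supp] by blast
    \<comment> \<open>\<open>k\<close> is controlled only on words supported in group
      \<open>i\<close>; cutting it off there keeps these products and confines its support.\<close>
    define h where "h = (\<chi> a. if g a = i then k $ a else 0)"
    have "dot h (word p) = 0" for p
    proof -
      have "dot h (word p) = dot k (A *v p i)"
        unfolding dot_def [of h] dot_def [of k]
        by (intro sum.cong) (auto simp: h_def word_def A_nth)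
      also have "\<dots> = 0" using k range_A by blast
      finally show ?thesis .
    qed
    then have "h \<in> dual_code C"
      by (auto simp: dual_code_iff C_iff)
    \<comment> \<open>If \<open>k\<close> vanished at \<open>a\<close>, the unit vector at
      \<open>a\<close> would come from some nonzero \<open>q\<close> that is a zero of the other
      three equations of the group, exceeding the bound 2.\<close>
    moreover have "k $ a \<noteq> 0" if "g a = i" for a
    proof
      assume "k $ a = 0"
      then have "dot k (axis a 1) = 0" by (simp add: dot_axis)
      moreover have "supp (axis a (1::'a)) \<subseteq> G i"
        using that by (auto simp: supp_def axis_nth_if G_def)
      ultimately obtain q where q: "axis a 1 = A *v q"
        using k by blast
      then have "q \<noteq> 0"
        by (metis axis_eq_0_iff matrix_vector_mult_0_right zero_neq_one)
      have "dot (f b) q = 0" if "b \<in> G i - {a}" for b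
        using A_nth [of q b] that by (simp add: q [symmetric] axis_nth_if G_def)
      then have "card (G i - {a}) \<le> card {a \<in> G i. dot (f a) q = 0}"
        by (intro card_mono) auto
      moreover have "card (G i - {a}) = 3"
        using card_G [OF i] that by (simp add: G_def)
      ultimately show False
        using few_zeros_group [OF i \<open>q \<noteq> 0\<close>] by simp
    qed
    then have "supp h = G i"
      by (auto simp: supp_def h_def G_def)
    ultimately show ?thesis by blast
  qed

  \<comment> \<open>Locality, optimality and disjoint repair groups\<close>
  then obtain h where h: "h i \<in> dual_code C" "supp (h i) = G i" if "i \<in> I" for i
    by metis
  have weight_h: "hamming_weight (h i) = 4" if "i \<in> I" for i
    using h card_G that by (simp add: hamming_weight_def)
  have "has_locality C 3"
    unfolding has_locality_def
  proof
    fix a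
    have "a \<in> supp (h (g a))" using h gI by (simp add: G_def)
    then show "\<exists>h\<in>dual_code C. a \<in> supp h \<and> hamming_weight h \<le> 3 + 1"
      using h(1) weight_h gI by (intro bexI [of _ "h (g a)"]) auto
  qed
  then have "singleton_optimal_lrc C 6 3"
    unfolding singleton_optimal_lrc_def n
    using code dim_C singleton_bound_iff [of l "vec.dim C"] by auto
  \<comment> \<open>The set of repair words must have exactly \<open>l\<close> elements; nonempty
    disjoint supports keep the words distinct.\<close>
  moreover have "inj_on h I"
  proof (rule inj_onI)
    fix i j assume ij: "i \<in> I" "j \<in> I" "h i = h j"
    have "G i = G j"
      using h(2) [OF ij(1)] h(2) [OF ij(2)] ij(3) by simp
    moreover have "G i \<noteq> {}"
      using card_G [OF ij(1)] by force
    ultimately show "i = j" by (auto simp: G_def)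
  qed
  then have "card (h ` I) = CARD('n) div (3 + 1)"
    by (simp add: card_image cardI n)
  moreover have "disjoint_family_on supp (h ` I)"
    unfolding disjoint_family_on_def using h by (auto simp: G_def)
  ultimately show ?thesis
    unfolding has_disjoint_repair_groups_def using h(1) weight_h n
    by (intro exI [of _ C] conjI exI [of _ "h ` I"]) auto
qed

theorem theorem2:
  fixes l :: nat
  assumes "4 dvd CARD('n)" and "l = CARD('n) div 4"
  shows "(\<exists>C :: ('a::{field,finite} ^ 'n::finite) set.
             singleton_optimal_lrc C 6 3 \<and> has_disjoint_repair_groups C 3)
         \<longleftrightarrow>
         (\<exists>B :: nat \<Rightarrow> ('a ^ 3) set set.
             (\<forall>i\<in>{1..l}. B i \<subseteq> pg2_lines \<and> card (B i) = 4) \<and>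
             (\<forall>i\<in>{1..l}. \<forall>j\<in>{1..l}. i \<noteq> j \<longrightarrow>
                 B i \<inter> B j = {} \<and> \<not> three_concurrent (B i \<union> B j)))"
    (is "?code \<longleftrightarrow> ?lines")
proof
  have n: "CARD('n) = 4 * l"
    using assms by simp
  show ?lines if code: ?code
  proof -
    obtain C :: "('a ^ 'n) set" where
      C: "singleton_optimal_lrc C 6 3" "has_disjoint_repair_groups C 3"
      using code by blast
    from C(1) obtain k where k: "linear_code C k 6"
        "6 = int (4 * l) - int k - \<lceil>real k / real 3\<rceil> + 2"
      unfolding singleton_optimal_lrc_def n by auto
    have sub: "vec.subspace C" and dim: "vec.dim C + 3 = 3 * l"
      using k(1) iffD1 [OF singleton_bound_iff k(2)] by (simp_all add: linear_code_def)
    have dist: "6 \<le> hamming_weight x" if "x \<in> C" "x \<noteq> 0" for x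
    proof -
      have "\<forall>x\<in>C. \<forall>y\<in>C. x \<noteq> y \<longrightarrow> 6 \<le> hamming_dist x y"
        using k(1) by (simp add: linear_code_def has_min_distance_def)
      then have "6 \<le> hamming_dist x 0"
        using that vec.subspace_0 [OF sub] by blast
      then show ?thesis by (simp add: hamming_dist_eq_weight)
    qed
    from C(2) obtain H where H: "H \<subseteq> dual_code C" "card H = l"
        "\<And>h. h \<in> H \<Longrightarrow> hamming_weight h = 4" "disjoint_family_on supp H"
      unfolding has_disjoint_repair_groups_def by (auto simp: n)
    have "\<exists>B :: 'a ^ 'n \<Rightarrow> ('a ^ 3) set set.
        (\<forall>h\<in>H. B h \<subseteq> pg2_lines \<and> card (B h) = 4) \<and>
        (\<forall>h\<in>H. \<forall>g\<in>H. h \<noteq> g \<longrightarrow> B h \<inter> B g = {} \<and> \<not> three_concurrent (B h \<union> B g))"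
      using sub dim n dist H by (rule pg2_lines_of_code)
    then obtain B :: "'a ^ 'n \<Rightarrow> ('a ^ 3) set set" where
      B: "\<forall>h\<in>H. B h \<subseteq> pg2_lines \<and> card (B h) = 4"
        "\<forall>h\<in>H. \<forall>g\<in>H. h \<noteq> g \<longrightarrow> B h \<inter> B g = {} \<and> \<not> three_concurrent (B h \<union> B g)"
      by blast
    have "finite H"
      using H(2) n card.infinite by fastforce
    \<comment> \<open>The sets of lines, so far indexed by repair words, are renumbered by
      \<open>{1..l}\<close>; injectivity of \<open>\<eta>\<close> carries over the conditions on
      distinct indices.\<close>
    then obtain \<eta> where \<eta>: "bij_betw \<eta> {1..l} H"
      using ex_bij_betw_nat_finite_1 [of H] H(2) by blast
    have "\<eta> i \<noteq> \<eta> j" if "i \<in> {1..l}" "j \<in> {1..l}" "i \<noteq> j" for i j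
      using \<eta> that by (meson bij_betw_imp_inj_on inj_onD)
    moreover have "\<eta> i \<in> H" if "i \<in> {1..l}" for i
      using bij_betw_apply [OF \<eta> that] .
    ultimately show ?thesis
      using B by (intro exI [of _ "\<lambda>i. B (\<eta> i)"] conjI ballI impI) blast+
  qed
  show ?code if lines: ?lines
  proof (cases "l = 1")
    case True
    then show ?thesis
      using zero_code_singleton_optimal [where 'a = 'a and 'n = 'n] n by auto
  next
    case False
    have "l \<noteq> 0"
      using n by (metis mult_0_right zero_less_card_finite less_irrefl)
    with False have "2 \<le> l" by linarith
    from lines obtain B :: "nat \<Rightarrow> ('a ^ 3) set set" where
      B: "\<forall>i\<in>{1..l}. B i \<subseteq> pg2_lines \<and> card (B i) = 4"
        "\<forall>i\<in>{1..l}. \<forall>j\<in>{1..l}. i \<noteq> j \<longrightarrow>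
          B i \<inter> B j = {} \<and> \<not> three_concurrent (B i \<union> B j)"
      by (elim exE conjE)
    show ?thesis
      by (rule code_of_pg2_lines [OF n \<open>2 \<le> l\<close>, of B]) (use B in blast)+
  qed
qed

end
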